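(* Let $\Omega\subset\mathbb{R}^3$ be a bounded domain, let $\mu_1,\mu_2,\mu_3$ be scalar fields on $\Omega$, let $\mathsf{B}=\mathsf{B}(\mathbf{x})$ be a tensor on $\Omega$, and suppose that, for almost every $\mathbf{x}$ in $\Omega$, $\mathsf{B}(\mathbf{x})$ is symmetric and positive definite with eigenvalues $\lambda_i(\mathsf{B}(\mathbf{x}))>0$, $i=1,2,3$. Then $\mathcal{A}(\mathsf{B})$ is a symmetric tensor and the eigenvalues of $\mathcal{A}(\mathsf{B}(\mathbf{x}))$ are given by $g_{\mathbf{x}}(\lambda_i(\mathsf{B}(\mathbf{x})))$, $i=1,2,3$, with the same corresponding eigenspaces as $\mathsf{B}(\mathbf{x})$, where $g_{\mathbf{x}}(\lambda)=\mu_1(\mathbf{x})+\mu_2(\mathbf{x})\lambda+\mu_3(\mathbf{x})/\lambda$ for $\lambda>0$. Moreover, $\mathsf{B}$ is $\mathcal{A}$-positive if, and only if, $$\alpha:=\operatorname*{ess\,inf}_{\mathbf{x}\in\Omega}\left\{\min_{i=1,2,3}\left(\mu_1(\mathbf{x})+\mu_2(\mathbf{x})\lambda_i(\mathsf{B}(\mathbf{x}))+\frac{\mu_3(\mathbf{x})}{\lambda_i(\mathsf{B}(\mathbf{x}))}\right)\right\}>0.$$ In this case, for almost every $\mathbf{x}\in\Omega$, $\mathcal{A}(\mathsf{B})(\mathbf{x})\boldsymbol{\xi}\cdot\boldsymbol{\xi}\ge\alpha|\boldsymbol{\xi}|^2$ for all $\boldsymbol{\xi}\in\mathbb{R}^3$,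 with this $\alpha$.
   Context: A tensor on $\Omega$ is a $3\times3$-matrix-valued function, and scalar fields are real-valued functions. $\mathcal{A}(\mathsf{B})=\mu_1\mathsf{I}+\mu_2\mathsf{B}+\mu_3\mathsf{B}^{-1}$, with $\mathsf{I}$ the identity matrix. $\lambda_1(\mathsf{B}(\mathbf{x}))\le\lambda_2(\mathsf{B}(\mathbf{x}))\le\lambda_3(\mathsf{B}(\mathbf{x}))$ are the eigenvalues of the symmetric matrix $\mathsf{B}(\mathbf{x})$. A symmetric tensor $\mathsf{A}$ on $\Omega$ is uniformly positive definite if there exists $\alpha>0$ such that, for a.e. $\mathbf{x}\in\Omega$, $\mathsf{A}(\mathbf{x})\boldsymbol{\xi}\cdot\boldsymbol{\xi}\ge\alpha|\boldsymbol{\xi}|^2$ for all $\boldsymbol{\xi}\in\mathbb{R}^3$. A positive definite symmetric tensor $\mathsf{B}$ is called $\mathcal{A}$-positive when $\mathcal{A}(\mathsf{B})$ is a uniformly positive definite symmetric tensor.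
   Formalization: "Same corresponding eigenspaces" fails if g_x takes equal values at distinct eigenvalues (e.g. μ2=μ3=0); proved instead: the eigenspace of A(B) for g_x(λ_i) is the span of all eigenspaces of B for λ_j with g_x(λ_j)=g_x(λ_i), so it equals B's when g_x separates the eigenvalues. *)

theory Defs
  imports "HOL-Analysis.Analysis" "HOL-Computational_Algebra.Computational_Algebra"
begin

section \<open>Eigenvalues and eigenspaces of real square matrices\<close>

definition charpoly :: "real^'n^'n \<Rightarrow> real poly"
  where "charpoly M = det (\<chi> i j. (if i = j then [:0, 1:] else 0) - [:M $ i $ j:])"

text \<open>Eigenvalues are counted with algebraic multiplicity. Only real roots of the characteristic
  polynomial are collected, which for a symmetric matrix are all of them.\<close>

definition eigenvalues :: "real^'n^'n \<Rightarrow> real multiset"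
  where "eigenvalues M = proots (charpoly M)"

text \<open>The increasing enumeration starts at index 1, as in
  \<open>\<lambda>\<^sub>1(M) \<le> \<lambda>\<^sub>2(M) \<le> \<lambda>\<^sub>3(M)\<close>. It is only meaningful for indices between 1 and
  the size of the multiset of eigenvalues.\<close>

definition eigval :: "real^'n^'n \<Rightarrow> nat \<Rightarrow> real"
  where "eigval M i = sorted_list_of_multiset (eigenvalues M) ! (i - 1)"

definition eigenspace :: "real^'n^'n \<Rightarrow> real \<Rightarrow> (real^'n) set"
  where "eigenspace M l = {v. M *v v = l *\<^sub>R v}"

definition symmetric_mat :: "real^'n^'n \<Rightarrow> bool"
  where "symmetric_mat M \<longleftrightarrow> transpose M = M"

definition pos_def_mat :: "real^'n^'n \<Rightarrow> bool"
  where "pos_def_mat M \<longleftrightarrow> (\<forall>\<xi>. \<xi> \<noteq> 0 \<longrightarrow> 0 < (M *v \<xi>) \<bullet> \<xi>)"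

lemma poly_charpoly: "poly (charpoly M) x = det (mat x - M)"
  by (auto simp: charpoly_def det_def poly_sum poly_prod mat_def sign_def
      intro!: sum.cong prod.cong)

lemma charpoly_neq_0: "charpoly M \<noteq> 0" for M :: "real^'n^'n"
proof
  assume "charpoly M = 0"
  then have sing: "det (mat x - M) = 0" for x
    by (metis poly_charpoly poly_0)
  have ker: "\<exists>v. v \<noteq> 0 \<and> M *v v = x *\<^sub>R v" for x
  proof -
    obtain v where "v \<noteq> 0" "(mat x - M) *v v = 0"
      using sing[of x] by (metis invertible_det_nz invertible_left_inverse matrix_left_invertible_ker)
    moreover have "mat x *v v = x *\<^sub>R v"
      by (simp add: matrix_vector_mult_def mat_def vec_eq_iff if_distrib if_distribR cong: if_cong)
    ultimately show ?thesis
      by (metis eq_iff_diff_eq_0 matrix_vector_mult_diff_rdistrib)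
  qed
  obtain K where K: "\<And>v. norm (M *v v) \<le> norm v * K"
    using bounded_linear.bounded[OF matrix_vector_mul_bounded_linear[of M]] by blast
  obtain v where v: "v \<noteq> 0" "M *v v = (\<bar>K\<bar> + 1) *\<^sub>R v"
    using ker by blast
  have "(\<bar>K\<bar> + 1) * norm v \<le> norm v * K"
    using K[of v] by (simp add: v)
  then show False
    using v(1) by (simp add: mult.commute)
qed

lemma eigenvalues_iff_eigenspace: "l \<in># eigenvalues M \<longleftrightarrow> eigenspace M l \<noteq> {0}"
proof -
  have m: "mat l *v v = l *\<^sub>R v" for v :: "real^'a"
    by (simp add: matrix_vector_mult_def mat_def vec_eq_iff if_distrib if_distribR cong: if_cong)
  have "l \<in># eigenvalues M \<longleftrightarrow> det (mat l - M) = 0"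
    by (simp add: eigenvalues_def charpoly_neq_0 poly_charpoly)
  also have "\<dots> \<longleftrightarrow> (\<exists>v. v \<noteq> 0 \<and> (mat l - M) *v v = 0)"
    by (metis invertible_det_nz invertible_left_inverse matrix_left_invertible_ker
        matrix_vector_mult_0_right)
  also have "\<dots> \<longleftrightarrow> (\<exists>v. v \<noteq> 0 \<and> M *v v = l *\<^sub>R v)"
    by (metis m eq_iff_diff_eq_0 matrix_vector_mult_diff_rdistrib)
  also have "\<dots> \<longleftrightarrow> eigenspace M l \<noteq> {0}"
    by (auto simp: eigenspace_def)
  finally show ?thesis .
qed

lemma eigenvalues_pos:
  assumes "pos_def_mat M" "l \<in># eigenvalues M"
  shows "0 < l"
proof -
  obtain v where v: "v \<noteq> 0" "M *v v = l *\<^sub>R v"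
    using assms(2) by (auto simp: eigenvalues_iff_eigenspace eigenspace_def)
  then have "0 < l * (v \<bullet> v)"
    using assms(1) by (metis pos_def_mat_def inner_scaleR_left)
  then show ?thesis
    using inner_ge_zero[of v] by (simp add: zero_less_mult_iff del: inner_ge_zero)
qed

section \<open>Tensors and scalar fields\<close>

text \<open>Fields on \<open>\<Omega>\<close> are total functions of which only the values on \<open>\<Omega>\<close> matter. As usual for
  such fields, pointwise properties are required almost everywhere in \<open>\<Omega>\<close> only.\<close>

type_synonym scalar_field = "real^3 \<Rightarrow> real"
type_synonym tensor = "real^3 \<Rightarrow> real^3^3"

definition symmetric_tensor :: "(real^3) set \<Rightarrow> tensor \<Rightarrow> bool"
  where "symmetric_tensor \<Omega> A \<longleftrightarrow> (AE x in lebesgue_on \<Omega>. symmetric_mat (A x))"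

definition pos_def_tensor :: "(real^3) set \<Rightarrow> tensor \<Rightarrow> bool"
  where "pos_def_tensor \<Omega> A \<longleftrightarrow> (AE x in lebesgue_on \<Omega>. pos_def_mat (A x))"

definition unif_pos_def_tensor :: "(real^3) set \<Rightarrow> tensor \<Rightarrow> bool"
  where "unif_pos_def_tensor \<Omega> A \<longleftrightarrow>
    (\<exists>\<alpha>>0. AE x in lebesgue_on \<Omega>. \<forall>\<xi>. (A x *v \<xi>) \<bullet> \<xi> \<ge> \<alpha> * (norm \<xi>)\<^sup>2)"

definition calA :: "scalar_field \<Rightarrow> scalar_field \<Rightarrow> scalar_field \<Rightarrow> tensor \<Rightarrow> tensor"
  where "calA \<mu>1 \<mu>2 \<mu>3 B x = \<mu>1 x *\<^sub>R mat 1 + \<mu>2 x *\<^sub>R B x + \<mu>3 x *\<^sub>R matrix_inv (B x)"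

definition gfun :: "scalar_field \<Rightarrow> scalar_field \<Rightarrow> scalar_field \<Rightarrow> real^3 \<Rightarrow> real \<Rightarrow> real"
  where "gfun \<mu>1 \<mu>2 \<mu>3 x l = \<mu>1 x + \<mu>2 x * l + \<mu>3 x / l"

definition A_positive ::
    "(real^3) set \<Rightarrow> scalar_field \<Rightarrow> scalar_field \<Rightarrow> scalar_field \<Rightarrow> tensor \<Rightarrow> bool"
  where "A_positive \<Omega> \<mu>1 \<mu>2 \<mu>3 B \<longleftrightarrow>
    symmetric_tensor \<Omega> B \<and> pos_def_tensor \<Omega> B \<and>
    symmetric_tensor \<Omega> (calA \<mu>1 \<mu>2 \<mu>3 B) \<and> unif_pos_def_tensor \<Omega> (calA \<mu>1 \<mu>2 \<mu>3 B)"

section \<open>Essential infimum\<close>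

text \<open>The fields are not assumed to be measurable. The library's \<open>esssup\<close> is \<open>Limsup\<close> along
  \<open>ae_filter\<close> for measurable functions but \<open>top\<close> by convention for all others, so the
  essential infimum is defined here as \<open>Liminf\<close> along the same filter, with no such case
  distinction.\<close>

definition essinf :: "'a measure \<Rightarrow> ('a \<Rightarrow> ereal) \<Rightarrow> ereal"
  where "essinf M f = Liminf (ae_filter M) f"

lemma essinf_eq_AE: "essinf M f = Sup {c. AE x in M. c \<le> f x}"
  unfolding essinf_def Liminf_def
proof (intro antisym SUP_least Sup_least; clarsimp)
  fix P assume P: "AE x in M. P x"
  show "(INF x\<in>Collect P. f x) \<le> Sup {c. AE x in M. c \<le> f x}"
    by (rule Sup_upper) (use P in \<open>auto elim!: eventually_mono intro: INF_lower\<close>)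
next
  fix c assume "AE x in M. c \<le> f x"
  then have "(\<lambda>x. c \<le> f x) \<in> {P. AE x in M. P x}" by simp
  then show "c \<le> (SUP P\<in>{P. AE x in M. P x}. INF x\<in>Collect P. f x)"
    by (rule SUP_upper2) (auto intro: INF_greatest)
qed

end

theory Submission
  imports Defs
begin

text \<open>
  The idea is that \<open>\<A>(B) = \<mu>\<^sub>1 I + \<mu>\<^sub>2 B + \<mu>\<^sub>3 B\<^sup>-\<^sup>1\<close> is a function of \<open>B\<close>, so that both matrices are
  diagonal in the same orthonormal basis. Fix a point at which \<open>B\<close> is symmetric and positive
  definite. By the spectral theorem (\<open>symmetric_mat_orthonormal_eigenbasis\<close>) \<open>B\<close> has an
  orthonormal basis of eigenvectors \<open>v\<^sub>i\<close> with eigenvalues \<open>d\<^sub>i > 0\<close>, and \<open>\<A>(B) v\<^sub>i = g(d\<^sub>i) v\<^sub>i\<close>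
  because \<open>B\<^sup>-\<^sup>1 v\<^sub>i = v\<^sub>i / d\<^sub>i\<close>. Everything about \<open>\<A>(B)\<close> at this point can be read off from that:
  it is symmetric, its eigenvalues with multiplicity are the \<open>g(d\<^sub>i)\<close>, and each of its eigenspaces
  is spanned by the \<open>v\<^sub>i\<close> that belong to it. Distinct eigenvalues of \<open>B\<close> can have the same image
  under \<open>g\<close>, in which case the corresponding eigenspaces of \<open>B\<close> are merged into one.

  For the criterion, write a vector in the basis \<open>v\<^sub>i\<close>: the inequality
  \<open>c |\<xi>|\<^sup>2 \<le> \<A>(B) \<xi> \<bullet> \<xi>\<close> holds for all \<open>\<xi>\<close> exactly when \<open>c\<close> is a lower bound of the eigenvalues
  \<open>g(d\<^sub>i)\<close>, that is, of their minimum (\<open>quadratic_form_ge_iff\<close>). Uniform positive definiteness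
  thus says that this minimum has a positive lower bound almost everywhere, which means that its
  essential infimum \<open>\<alpha>\<close> is positive. Since the essential infimum is itself a lower bound almost
  everywhere (\<open>essinf_AE_le\<close>), \<open>\<alpha>\<close> is an admissible constant.
\<close>

section \<open>The spectral theorem for real symmetric matrices\<close>

lemma symmetric_mat_self_adjoint:
  assumes "symmetric_mat M"
  shows "(M *v x) \<bullet> y = x \<bullet> (M *v y)"
  using assms by (metis dot_lmul_matrix symmetric_mat_def transpose_matrix_vector)

lemma self_adjoint_symmetric_mat:
  assumes "\<And>x y. (M *v x) \<bullet> y = x \<bullet> (M *v y)"
  shows "symmetric_mat M"
proof -
  have "(transpose M *v x) \<bullet> y = (M *v x) \<bullet> y" for x y
    using assms[of x y] by (simp add: dot_lmul_matrix)
  then have "transpose M *v x = M *v x" for x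
    using vector_eq_rdot by blast
  then show ?thesis
    by (simp add: symmetric_mat_def matrix_eq)
qed

lemma linear_coefficient_zero:
  fixes b c :: real
  assumes "\<And>t. 0 \<le> 2 * t * b + t\<^sup>2 * c"
  shows "b = 0"
proof (rule ccontr)
  assume b: "b \<noteq> 0"
  have c: "\<bar>c\<bar> + 1 > 0" by simp
  \<comment> \<open>A small step against the sign of the linear coefficient makes the value negative.\<close>
  define t where "t = - b / (\<bar>c\<bar> + 1)"
  have tc: "t * (\<bar>c\<bar> + 1) = - b" using c by (simp add: t_def)
  have "t\<^sup>2 * c \<le> t\<^sup>2 * (\<bar>c\<bar> + 1)" by (intro mult_left_mono) auto
  also have "\<dots> = - t * b" using tc by (simp add: power2_eq_square mult.assoc)
  finally have "0 \<le> t * b" using assms[of t] by linarith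
  then have "0 \<le> - (b\<^sup>2 / (\<bar>c\<bar> + 1))" by (simp add: t_def power2_eq_square)
  moreover have "b\<^sup>2 / (\<bar>c\<bar> + 1) > 0" using b c by simp
  ultimately show False by linarith
qed

text \<open>A maximizer \<open>u\<close> of the quadratic form on the unit sphere of the subspace is an eigenvector.
  Let \<open>l\<close> be the maximum. The form \<open>l |x|\<^sup>2 - M x \<bullet> x\<close> is nonnegative on the subspace and vanishes
  at \<open>u\<close>, so its derivative at \<open>u\<close> in every direction \<open>w\<close> of the subspace is zero; the direction
  \<open>w = l u - M u\<close>, which lies in the subspace by invariance, then has to be zero.\<close>

lemma symmetric_mat_invariant_subspace_eigenvector:
  fixes M :: "real^'n^'n"
  assumes sym: "symmetric_mat M" and S: "subspace S"
    and inv: "\<And>x. x \<in> S \<Longrightarrow> M *v x \<in> S" and x0: "x0 \<in> S" "x0 \<noteq> 0"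
  obtains u l where "u \<in> S" "norm u = 1" "M *v u = l *\<^sub>R u"
proof -
  have "compact (S \<inter> sphere 0 1)"
    by (rule closed_Int_compact[OF closed_subspace[OF S] compact_sphere])
  moreover have "x0 /\<^sub>R norm x0 \<in> S \<inter> sphere 0 1"
    using x0 S by (auto simp: subspace_scale)
  then have "S \<inter> sphere 0 1 \<noteq> {}" by blast
  moreover have "continuous_on (S \<inter> sphere 0 1) (\<lambda>x. (M *v x) \<bullet> x)"
    by (intro continuous_intros matrix_vector_mult_linear_continuous_on)
  ultimately have "\<exists>u\<in>S \<inter> sphere 0 1. \<forall>y\<in>S \<inter> sphere 0 1. (M *v y) \<bullet> y \<le> (M *v u) \<bullet> u"
    by (intro continuous_attains_sup)
  then obtain u where u: "u \<in> S" "norm u = 1"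
    and umax: "\<And>y. y \<in> S \<Longrightarrow> norm y = 1 \<Longrightarrow> (M *v y) \<bullet> y \<le> (M *v u) \<bullet> u"
    by (metis Int_iff mem_sphere_0)
  define l where "l = (M *v u) \<bullet> u"
  have le: "(M *v x) \<bullet> x \<le> l * (x \<bullet> x)" if x: "x \<in> S" for x
  proof (cases "x = 0")
    case False
    define y where "y = x /\<^sub>R norm x"
    have y: "y \<in> S" "norm y = 1" and xy: "x = norm x *\<^sub>R y"
      using x False S by (auto simp: y_def subspace_scale)
    have "(M *v x) \<bullet> x = (norm x)\<^sup>2 * ((M *v y) \<bullet> y)"
      by (subst (1 2) xy) (simp add: matrix_vector_mult_scaleR power2_eq_square)
    also have "\<dots> \<le> (norm x)\<^sup>2 * l"
      unfolding l_def by (intro mult_left_mono umax y) auto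
    finally show ?thesis by (simp add: power2_norm_eq_inner mult.commute)
  qed simp
  define w where "w = l *\<^sub>R u - M *v u"
  have w: "w \<in> S" using u inv S by (simp add: w_def subspace_diff subspace_scale)
  have uu: "u \<bullet> u = 1" using u by (simp add: dot_square_norm)
  have "0 \<le> 2 * t * (w \<bullet> w) + t\<^sup>2 * (l * (w \<bullet> w) - (M *v w) \<bullet> w)" for t
  proof -
    have "u + t *\<^sub>R w \<in> S" using u w S by (simp add: subspace_add subspace_scale)
    from le[OF this]
    have "l + t * ((M *v u) \<bullet> w + (M *v w) \<bullet> u) + t\<^sup>2 * ((M *v w) \<bullet> w)
        \<le> l + l * (2 * t * (u \<bullet> w)) + l * (t\<^sup>2 * (w \<bullet> w))"
      by (simp add: matrix_vector_right_distrib matrix_vector_mult_scaleR inner_add_left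
          inner_add_right uu l_def[symmetric] power2_eq_square inner_commute[of w u] algebra_simps)
    moreover have "(M *v w) \<bullet> u = (M *v u) \<bullet> w"
      using symmetric_mat_self_adjoint[OF sym, of w u] by (simp add: inner_commute)
    moreover have "l * (u \<bullet> w) = w \<bullet> w + (M *v u) \<bullet> w"
      by (subst (2) w_def) (simp add: inner_diff_left)
    then have "l * (2 * t * (u \<bullet> w)) = 2 * t * (w \<bullet> w) + 2 * t * ((M *v u) \<bullet> w)"
      by (metis distrib_left mult.left_commute)
    ultimately show ?thesis by (simp add: right_diff_distrib mult.left_commute)
  qed
  then have "w \<bullet> w = 0" by (rule linear_coefficient_zero)
  then have "M *v u = l *\<^sub>R u" by (simp add: w_def)
  then show ?thesis using that u by blast
qed

text \<open>The basis is indexed by the index type of the matrix, so that it can serve as the rows of a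
  square matrix.\<close>

definition orthonormal_eigenbasis :: "real^'n^'n \<Rightarrow> ('n \<Rightarrow> real^'n) \<Rightarrow> ('n \<Rightarrow> real) \<Rightarrow> bool"
  where "orthonormal_eigenbasis M v d \<longleftrightarrow>
    (\<forall>i j. v i \<bullet> v j = (if i = j then 1 else 0)) \<and> (\<forall>i. M *v v i = d i *\<^sub>R v i)"

text \<open>The orthogonal complement of a set of eigenvectors of a symmetric matrix is invariant, so as
  long as the set is not yet a basis, a further eigenvector can be found in the complement.\<close>

lemma symmetric_mat_orthonormal_eigenvectors:
  fixes M :: "real^'n^'n"
  assumes sym: "symmetric_mat M"
  shows "k \<le> CARD('n) \<Longrightarrow> \<exists>E. finite E \<and> card E = k \<and>
    (\<forall>e\<in>E. norm e = 1 \<and> (\<exists>l. M *v e = l *\<^sub>R e)) \<and> pairwise orthogonal E"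
proof (induction k)
  case 0
  show ?case by (rule exI[of _ "{}"]) simp
next
  case (Suc k)
  then obtain E where E: "finite E" "card E = k" "pairwise orthogonal E"
    and eig: "\<And>e. e \<in> E \<Longrightarrow> norm e = 1 \<and> (\<exists>l. M *v e = l *\<^sub>R e)" by auto
  define S where "S = {x. \<forall>e\<in>E. e \<bullet> x = 0}"
  have S: "subspace S"
    by (auto simp: S_def subspace_def inner_add_right)
  have inv: "M *v x \<in> S" if x: "x \<in> S" for x
    unfolding S_def
  proof clarify
    fix e assume e: "e \<in> E"
    then obtain l where "M *v e = l *\<^sub>R e" using eig by blast
    then show "e \<bullet> (M *v x) = 0"
      using symmetric_mat_self_adjoint[OF sym, of e x] x e by (simp add: S_def)
  qed
  have "dim E < DIM(real^'n)"
    using dim_le_card'[OF E(1)] E(2) Suc.prems by simp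
  then obtain x0 where x0: "x0 \<noteq> 0" "\<And>y. y \<in> span E \<Longrightarrow> orthogonal x0 y"
    by (rule orthogonal_to_subspace_exists) blast
  then have "x0 \<in> S"
    by (auto simp: S_def orthogonal_def span_base inner_commute)
  then obtain u l where u: "u \<in> S" "norm u = 1" "M *v u = l *\<^sub>R u"
    using symmetric_mat_invariant_subspace_eigenvector[OF sym S inv] x0 by blast
  have "u \<notin> E"
  proof
    assume "u \<in> E"
    then have "u \<bullet> u = 0" using u(1) by (simp add: S_def)
    then show False using u(2) by simp
  qed
  moreover have "pairwise orthogonal (insert u E)"
    using E(3) u(1) by (auto simp: pairwise_insert S_def orthogonal_def inner_commute)
  ultimately show ?case
    using E eig u by (intro exI[of _ "insert u E"]) auto
qed

lemma symmetric_mat_orthonormal_eigenbasis: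
  fixes M :: "real^'n^'n"
  assumes "symmetric_mat M"
  obtains v d where "orthonormal_eigenbasis M v d"
proof -
  obtain E :: "(real^'n) set" where E: "finite E" "card E = CARD('n)" "pairwise orthogonal E"
    and eig: "\<And>e. e \<in> E \<Longrightarrow> norm e = 1 \<and> (\<exists>l. M *v e = l *\<^sub>R e)"
    using symmetric_mat_orthonormal_eigenvectors[OF assms order_refl] by blast
  obtain v :: "'n \<Rightarrow> real^'n" where v: "bij_betw v UNIV E"
    using finite_same_card_bij[of "UNIV :: 'n set" E] E by auto
  have vE: "v i \<in> E" for i using v by (auto simp: bij_betw_def)
  have "v i \<bullet> v j = (if i = j then 1 else 0)" for i j
  proof (cases "i = j")
    case True
    then show ?thesis using eig[OF vE[of i]] by (simp add: dot_square_norm)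
  next
    case False
    then have "v i \<noteq> v j" using v by (auto simp: bij_betw_def inj_on_def)
    then show ?thesis using False E(3) vE by (auto simp: pairwise_def orthogonal_def)
  qed
  moreover have "\<exists>d. \<forall>i. M *v v i = d i *\<^sub>R v i"
    using eig[OF vE] by (intro choice) blast
  ultimately show ?thesis
    using that unfolding orthonormal_eigenbasis_def by blast
qed

section \<open>What an orthonormal eigenbasis determines\<close>

lemma orthonormal_eigenbasis_inner:
  "orthonormal_eigenbasis M v d \<Longrightarrow> v i \<bullet> v j = (if i = j then 1 else 0)"
  by (simp add: orthonormal_eigenbasis_def)

lemma orthonormal_eigenbasis_mult:
  "orthonormal_eigenbasis M v d \<Longrightarrow> M *v v i = d i *\<^sub>R v i"
  by (simp add: orthonormal_eigenbasis_def)

lemma orthonormal_eigenbasis_matrix: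
  assumes "orthonormal_eigenbasis M v d"
  shows "(\<chi> i. v i) ** transpose (\<chi> i. v i) = mat 1"
  using orthonormal_eigenbasis_inner[OF assms]
  by (simp add: vec_eq_iff matrix_matrix_mult_def transpose_def mat_def inner_vec_def)

lemma orthonormal_eigenbasis_expansion:
  assumes "orthonormal_eigenbasis M v d"
  shows "x = (\<Sum>i\<in>UNIV. (v i \<bullet> x) *\<^sub>R v i)"
proof -
  have "x = (transpose (\<chi> i. v i) ** (\<chi> i. v i)) *v x"
    using orthonormal_eigenbasis_matrix[OF assms] matrix_left_right_inverse
    by (metis matrix_vector_mul_lid)
  also have "\<dots> = transpose (\<chi> i. v i) *v (\<chi> i. v i \<bullet> x)"
    by (simp only: matrix_vector_mul_assoc[symmetric] matrix_mult_dot[of "\<chi> i. v i"] vec_lambda_beta)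
  also have "\<dots> = (\<Sum>i\<in>UNIV. (v i \<bullet> x) *\<^sub>R v i)"
    by (simp add: vec_eq_iff matrix_vector_mult_def transpose_def mult.commute
        del: transpose_matrix_vector)
  finally show ?thesis .
qed

lemma orthonormal_eigenbasis_bilinear:
  assumes "orthonormal_eigenbasis M v d"
  shows "(M *v x) \<bullet> y = (\<Sum>i\<in>UNIV. d i * ((v i \<bullet> x) * (v i \<bullet> y)))"
proof -
  have "M *v x = (\<Sum>i\<in>UNIV. (v i \<bullet> x) *\<^sub>R (d i *\<^sub>R v i))"
    by (subst orthonormal_eigenbasis_expansion[OF assms, of x])
      (simp add: linear_sum[OF matrix_vector_mul_linear] matrix_vector_mult_scaleR
        orthonormal_eigenbasis_mult[OF assms])
  then show ?thesis
    by (simp add: inner_sum_left mult_ac)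
qed

lemma orthonormal_eigenbasis_symmetric_mat:
  assumes "orthonormal_eigenbasis M v d"
  shows "symmetric_mat M"
  by (rule self_adjoint_symmetric_mat)
    (simp add: inner_commute[of _ "M *v _"] orthonormal_eigenbasis_bilinear[OF assms] mult.commute)

lemma orthonormal_eigenbasis_norm:
  assumes "orthonormal_eigenbasis M v d"
  shows "(norm x)\<^sup>2 = (\<Sum>i\<in>UNIV. (v i \<bullet> x)\<^sup>2)"
proof -
  have "orthonormal_eigenbasis (mat 1) v (\<lambda>_. 1)"
    using assms by (simp add: orthonormal_eigenbasis_def)
  from orthonormal_eigenbasis_bilinear[OF this, of x x] show ?thesis
    by (simp add: power2_norm_eq_inner power2_eq_square[of "_ \<bullet> _"])
qed

text \<open>Changing to the eigenbasis turns \<open>x I - M\<close> into a diagonal matrix without affecting the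
  determinant, so the characteristic polynomial splits into the factors \<open>X - d\<^sub>i\<close>.\<close>

lemma orthonormal_eigenbasis_eigenvalues:
  fixes M :: "real^'n^'n"
  assumes "orthonormal_eigenbasis M v d"
  shows "eigenvalues M = image_mset d (mset_set UNIV)"
proof -
  define P :: "real^'n^'n" where "P = (\<chi> i. v i)"
  have PP: "P ** transpose P = mat 1"
    unfolding P_def by (rule orthonormal_eigenbasis_matrix[OF assms])
  have "det (mat x - M) = (\<Prod>i\<in>UNIV. x - d i)" for x
  proof -
    have "mat x *v v j = x *\<^sub>R v j" for j
      by (simp add: matrix_vector_mult_def mat_def vec_eq_iff if_distrib if_distribR cong: if_cong)
    then have col: "(mat x - M) *v v j = (x - d j) *\<^sub>R v j" for j
      by (simp add: matrix_vector_mult_diff_rdistrib orthonormal_eigenbasis_mult[OF assms]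
          scaleR_left_diff_distrib)
    have entry: "(P ** ((mat x - M) ** transpose P)) $ i $ j = v i \<bullet> ((mat x - M) *v v j)" for i j
      by (simp add: P_def matrix_matrix_mult_def matrix_vector_mult_def transpose_def inner_vec_def)
    have "det (P ** ((mat x - M) ** transpose P)) = (\<Prod>i\<in>UNIV. x - d i)"
      by (subst det_diagonal) (simp_all add: entry col orthonormal_eigenbasis_inner[OF assms])
    moreover have "det P * det (transpose P) = 1"
      using PP by (metis det_mul det_I)
    ultimately show ?thesis
      by (metis det_mul det_transpose mult.assoc mult.commute mult_1)
  qed
  then have "charpoly M = (\<Prod>i\<in>UNIV. [:- d i, 1:])"
    by (intro poly_eq_poly_eq_iff[THEN iffD1] ext) (simp add: poly_charpoly poly_prod)
  then have "eigenvalues M = (\<Sum>i\<in>UNIV. {#d i#})"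
    by (simp add: eigenvalues_def proots_prod)
  also have "\<dots> = image_mset d (mset_set UNIV)"
    by (simp add: sum_unfold_sum_mset)
  finally show ?thesis .
qed

lemma orthonormal_eigenbasis_eigenspace:
  assumes "orthonormal_eigenbasis M v d"
  shows "eigenspace M l \<subseteq> span {v i | i. d i = l}"
proof
  fix x assume x: "x \<in> eigenspace M l"
  \<comment> \<open>Comparing coefficients in \<open>M x = l x\<close>: only the \<open>v\<^sub>i\<close> with \<open>d\<^sub>i = l\<close> contribute to \<open>x\<close>.\<close>
  have "v i \<bullet> x = 0" if "d i \<noteq> l" for i
  proof -
    have "l * (v i \<bullet> x) = v i \<bullet> (M *v x)"
      using x by (simp add: eigenspace_def)
    also have "\<dots> = (M *v v i) \<bullet> x"
      by (simp add: symmetric_mat_self_adjoint[OF orthonormal_eigenbasis_symmetric_mat[OF assms]])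
    also have "\<dots> = d i * (v i \<bullet> x)"
      by (simp add: orthonormal_eigenbasis_mult[OF assms])
    finally show ?thesis using that by simp
  qed
  then have "(v i \<bullet> x) *\<^sub>R v i \<in> span {v i | i. d i = l}" for i
    by (cases "d i = l") (auto intro: span_scale span_base span_zero)
  then show "x \<in> span {v i | i. d i = l}"
    by (subst orthonormal_eigenbasis_expansion[OF assms, of x]) (rule span_sum)
qed

text \<open>This is the Rayleigh characterization of the smallest eigenvalue: in an eigenbasis the form is
  \<open>\<Sum>\<^sub>i d\<^sub>i (v\<^sub>i \<bullet> \<xi>)\<^sup>2\<close> and \<open>|\<xi>|\<^sup>2\<close> is \<open>\<Sum>\<^sub>i (v\<^sub>i \<bullet> \<xi>)\<^sup>2\<close>.\<close>

lemma quadratic_form_ge_iff: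
  fixes M :: "real^'n^'n"
  assumes "symmetric_mat M"
  shows "(\<forall>\<xi>. c * (norm \<xi>)\<^sup>2 \<le> (M *v \<xi>) \<bullet> \<xi>) \<longleftrightarrow> (\<forall>l\<in>#eigenvalues M. c \<le> l)"
proof -
  obtain v d where vd: "orthonormal_eigenbasis M v d"
    using symmetric_mat_orthonormal_eigenbasis[OF assms] .
  have "(\<forall>\<xi>. c * (norm \<xi>)\<^sup>2 \<le> (M *v \<xi>) \<bullet> \<xi>) \<longleftrightarrow> (\<forall>i. c \<le> d i)"
  proof (intro iffI allI)
    fix i assume "\<forall>\<xi>. c * (norm \<xi>)\<^sup>2 \<le> (M *v \<xi>) \<bullet> \<xi>"
    then have "c * (norm (v i))\<^sup>2 \<le> (M *v v i) \<bullet> v i" by blast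
    then show "c \<le> d i"
      by (simp add: power2_norm_eq_inner orthonormal_eigenbasis_mult[OF vd]
          orthonormal_eigenbasis_inner[OF vd])
  next
    fix \<xi> assume "\<forall>i. c \<le> d i"
    then have "(\<Sum>i\<in>UNIV. c * (v i \<bullet> \<xi>)\<^sup>2) \<le> (\<Sum>i\<in>UNIV. d i * (v i \<bullet> \<xi>)\<^sup>2)"
      by (intro sum_mono mult_right_mono) auto
    then show "c * (norm \<xi>)\<^sup>2 \<le> (M *v \<xi>) \<bullet> \<xi>"
      by (simp add: orthonormal_eigenbasis_norm[OF vd] orthonormal_eigenbasis_bilinear[OF vd]
          sum_distrib_left power2_eq_square[of "_ \<bullet> _"])
  qed
  then show ?thesis
    by (simp add: orthonormal_eigenbasis_eigenvalues[OF vd])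
qed

lemma eigenvalues_eq_eigvals:
  fixes M :: "real^3^3"
  assumes "symmetric_mat M"
  shows "eigenvalues M = {#eigval M 1, eigval M 2, eigval M 3#}"
proof -
  obtain v d where "orthonormal_eigenbasis M v d"
    using symmetric_mat_orthonormal_eigenbasis[OF assms] .
  then have "size (eigenvalues M) = 3"
    by (simp add: orthonormal_eigenbasis_eigenvalues)
  then have "length (sorted_list_of_multiset (eigenvalues M)) = 3"
    by (metis mset_sorted_list_of_multiset size_mset)
  then obtain a b c where abc: "sorted_list_of_multiset (eigenvalues M) = [a, b, c]"
    by (auto simp: numeral_3_eq_3 length_Suc_conv)
  then have "eigenvalues M = {#a, b, c#}"
    by (metis mset.simps mset_sorted_list_of_multiset)
  with abc show ?thesis by (simp add: eigval_def)
qed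

section \<open>The matrix function \<open>\<A>\<close> at a point\<close>

lemma pos_def_mat_invertible:
  fixes M :: "real^'n^'n"
  assumes "pos_def_mat M"
  shows "invertible M"
proof -
  have "x = 0" if "M *v x = 0" for x
    using assms that unfolding pos_def_mat_def by (metis inner_zero_left less_irrefl)
  then show ?thesis
    by (simp add: invertible_left_inverse matrix_left_invertible_ker)
qed

lemma matrix_inv_mult_left:
  assumes "invertible M"
  shows "matrix_inv M ** M = mat 1"
  using assms someI_ex[of "\<lambda>N. M ** N = mat 1 \<and> N ** M = mat 1"]
  by (simp add: invertible_def matrix_inv_def)

lemma eigenspace_subset_eigenspace_calA:
  assumes "invertible (B x)" "l \<noteq> 0"
  shows "eigenspace (B x) l \<subseteq> eigenspace (calA \<mu>1 \<mu>2 \<mu>3 B x) (gfun \<mu>1 \<mu>2 \<mu>3 x l)"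
proof
  fix u assume "u \<in> eigenspace (B x) l"
  then have u: "B x *v u = l *\<^sub>R u" by (simp add: eigenspace_def)
  have "u = (matrix_inv (B x) ** B x) *v u"
    using assms(1) by (simp add: matrix_inv_mult_left)
  also have "\<dots> = l *\<^sub>R (matrix_inv (B x) *v u)"
    by (simp add: matrix_vector_mul_assoc[symmetric] u matrix_vector_mult_scaleR)
  finally have "matrix_inv (B x) *v u = (1 / l) *\<^sub>R u"
    using assms(2) by (metis divide_inverse_commute mult.right_neutral scaleR_one scaleR_scaleR
        right_inverse mult.commute)
  then show "u \<in> eigenspace (calA \<mu>1 \<mu>2 \<mu>3 B x) (gfun \<mu>1 \<mu>2 \<mu>3 x l)"
    by (simp add: eigenspace_def calA_def gfun_def matrix_vector_mult_add_rdistrib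
        scaleR_matrix_vector_assoc[symmetric] u scaleR_left_distrib)
qed

lemma orthonormal_eigenbasis_calA:
  assumes pd: "pos_def_mat (B x)" and vd: "orthonormal_eigenbasis (B x) v d"
  shows "orthonormal_eigenbasis (calA \<mu>1 \<mu>2 \<mu>3 B x) v (\<lambda>i. gfun \<mu>1 \<mu>2 \<mu>3 x (d i))"
proof -
  have "d i > 0" for i
    using eigenvalues_pos[OF pd, of "d i"] by (simp add: orthonormal_eigenbasis_eigenvalues[OF vd])
  moreover have "v i \<in> eigenspace (B x) (d i)" for i
    by (simp add: eigenspace_def orthonormal_eigenbasis_mult[OF vd])
  ultimately have "v i \<in> eigenspace (calA \<mu>1 \<mu>2 \<mu>3 B x) (gfun \<mu>1 \<mu>2 \<mu>3 x (d i))" for i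
    using eigenspace_subset_eigenspace_calA[where B = B and x = x, OF pos_def_mat_invertible[OF pd]]
    by (metis less_irrefl subsetD)
  with vd show ?thesis
    by (simp add: orthonormal_eigenbasis_def eigenspace_def)
qed

lemma
  assumes "symmetric_mat (B x)" "pos_def_mat (B x)"
  shows symmetric_mat_calA: "symmetric_mat (calA \<mu>1 \<mu>2 \<mu>3 B x)"
    and eigenvalues_calA: "eigenvalues (calA \<mu>1 \<mu>2 \<mu>3 B x) =
      image_mset (gfun \<mu>1 \<mu>2 \<mu>3 x) (eigenvalues (B x))"
proof -
  obtain v d where vd: "orthonormal_eigenbasis (B x) v d"
    using symmetric_mat_orthonormal_eigenbasis[OF assms(1)] .
  note vd' = orthonormal_eigenbasis_calA[where B = B and x = x, OF assms(2) vd]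
  show "symmetric_mat (calA \<mu>1 \<mu>2 \<mu>3 B x)"
    by (rule orthonormal_eigenbasis_symmetric_mat[OF vd'])
  show "eigenvalues (calA \<mu>1 \<mu>2 \<mu>3 B x) =
      image_mset (gfun \<mu>1 \<mu>2 \<mu>3 x) (eigenvalues (B x))"
    by (simp add: orthonormal_eigenbasis_eigenvalues[OF vd]
        orthonormal_eigenbasis_eigenvalues[OF vd'] multiset.map_comp o_def)
qed

text \<open>An eigenspace of \<open>\<A>(B)\<close> can be larger than that of \<open>B\<close> because \<open>g\<close> need not be injective; it
  is the span of all eigenspaces of \<open>B\<close> whose eigenvalues have the same image.\<close>

lemma eigenspace_calA:
  assumes sym: "symmetric_mat (B x)" and pd: "pos_def_mat (B x)"
  shows "eigenspace (calA \<mu>1 \<mu>2 \<mu>3 B x) m =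
    span (\<Union>l\<in>{l \<in> set_mset (eigenvalues (B x)). gfun \<mu>1 \<mu>2 \<mu>3 x l = m}. eigenspace (B x) l)"
    (is "_ = span ?U")
proof
  obtain v d where vd: "orthonormal_eigenbasis (B x) v d"
    using symmetric_mat_orthonormal_eigenbasis[OF sym] .
  have "{v i | i. gfun \<mu>1 \<mu>2 \<mu>3 x (d i) = m} \<subseteq> ?U"
    using orthonormal_eigenbasis_mult[OF vd]
    by (auto simp: orthonormal_eigenbasis_eigenvalues[OF vd] eigenspace_def)
  then show "eigenspace (calA \<mu>1 \<mu>2 \<mu>3 B x) m \<subseteq> span ?U"
    by (intro order_trans[OF orthonormal_eigenbasis_eigenspace[OF
            orthonormal_eigenbasis_calA[where B = B and x = x, OF pd vd]]] span_mono)
  have "l \<noteq> 0" if "l \<in># eigenvalues (B x)" for l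
    using eigenvalues_pos[OF pd that] by simp
  then have "eigenspace (B x) l \<subseteq> eigenspace (calA \<mu>1 \<mu>2 \<mu>3 B x) m"
    if "l \<in># eigenvalues (B x)" "gfun \<mu>1 \<mu>2 \<mu>3 x l = m" for l
    using eigenspace_subset_eigenspace_calA[where B = B and x = x and l = l,
        OF pos_def_mat_invertible[OF pd]] that by metis
  then have "?U \<subseteq> eigenspace (calA \<mu>1 \<mu>2 \<mu>3 B x) m"
    by (intro UN_least) simp
  moreover have "subspace (eigenspace (calA \<mu>1 \<mu>2 \<mu>3 B x) m)"
    by (auto simp: subspace_def eigenspace_def matrix_vector_right_distrib
        matrix_vector_mult_scaleR scaleR_right_distrib)
  ultimately show "span ?U \<subseteq> eigenspace (calA \<mu>1 \<mu>2 \<mu>3 B x) m"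
    by (rule span_minimal)
qed

section \<open>The essential infimum as a lower bound\<close>

text \<open>The supremum of the almost-everywhere lower bounds is the limit of a sequence of them, and
  countably many exceptional null sets can be discarded together.\<close>

lemma essinf_AE_le: "AE x in M. essinf M f \<le> f x"
proof -
  define C where "C = {c. AE x in M. c \<le> f x}"
  have "- \<infinity> \<in> C" by (simp add: C_def)
  then obtain c :: "nat \<Rightarrow> ereal" where c: "range c \<subseteq> C" "Sup C = (SUP n. c n)"
    using Sup_countable_SUP[of C] by auto
  have "AE x in M. \<forall>n. c n \<le> f x"
    using c(1) by (auto simp: AE_all_countable C_def)
  then show ?thesis
    by eventually_elim (auto simp: essinf_eq_AE C_def[symmetric] c(2) intro: SUP_least)
qed

lemma essinf_upper: "AE x in M. c \<le> f x \<Longrightarrow> c \<le> essinf M f"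
  unfolding essinf_eq_AE by (rule Sup_upper) simp

section \<open>Spectrum and positivity of \<open>\<A>(B)\<close>\<close>

theorem proposition5p1:
  fixes \<Omega> :: "(real^3) set"
    and \<mu>1 \<mu>2 \<mu>3 :: scalar_field
    and B :: tensor
    and \<alpha> :: ereal
  assumes "open \<Omega>" "connected \<Omega>" "\<Omega> \<noteq> {}" "bounded \<Omega>"
    and "AE x in lebesgue_on \<Omega>. symmetric_mat (B x) \<and> pos_def_mat (B x)"
    and \<alpha>_eq: "\<alpha> = essinf (lebesgue_on \<Omega>) (\<lambda>x. ereal (Min ((\<lambda>i.
           \<mu>1 x + \<mu>2 x * eigval (B x) i + \<mu>3 x / eigval (B x) i) ` {1, 2, 3})))"
  shows "symmetric_tensor \<Omega> (calA \<mu>1 \<mu>2 \<mu>3 B) \<and>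
    (AE x in lebesgue_on \<Omega>.
       eigenvalues (calA \<mu>1 \<mu>2 \<mu>3 B x) =
         {# gfun \<mu>1 \<mu>2 \<mu>3 x (eigval (B x) 1),
            gfun \<mu>1 \<mu>2 \<mu>3 x (eigval (B x) 2),
            gfun \<mu>1 \<mu>2 \<mu>3 x (eigval (B x) 3) #} \<and>
       (\<forall>i\<in>{1, 2, 3}.
          eigenspace (B x) (eigval (B x) i)
            \<subseteq> eigenspace (calA \<mu>1 \<mu>2 \<mu>3 B x) (gfun \<mu>1 \<mu>2 \<mu>3 x (eigval (B x) i)) \<and>
          eigenspace (calA \<mu>1 \<mu>2 \<mu>3 B x) (gfun \<mu>1 \<mu>2 \<mu>3 x (eigval (B x) i)) =
            span (\<Union>j\<in>{j \<in> {1, 2, 3}. gfun \<mu>1 \<mu>2 \<mu>3 x (eigval (B x) j) =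
                                  gfun \<mu>1 \<mu>2 \<mu>3 x (eigval (B x) i)}.
                    eigenspace (B x) (eigval (B x) j)))) \<and>
    (A_positive \<Omega> \<mu>1 \<mu>2 \<mu>3 B \<longleftrightarrow> 0 < \<alpha>) \<and>
    (A_positive \<Omega> \<mu>1 \<mu>2 \<mu>3 B \<longrightarrow>
       (AE x in lebesgue_on \<Omega>. \<forall>\<xi>.
          ereal ((calA \<mu>1 \<mu>2 \<mu>3 B x *v \<xi>) \<bullet> \<xi>) \<ge> \<alpha> * ereal ((norm \<xi>)\<^sup>2)))"
proof -
  let ?A = "calA \<mu>1 \<mu>2 \<mu>3 B"
  let ?g = "gfun \<mu>1 \<mu>2 \<mu>3"
  define m where "m x = Min ((\<lambda>i. ?g x (eigval (B x) i)) ` {1, 2, 3})" for x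
  have \<alpha>: "\<alpha> = essinf (lebesgue_on \<Omega>) (\<lambda>x. ereal (m x))"
    by (simp add: \<alpha>_eq m_def gfun_def)
  note good = assms(5)

  have symA: "symmetric_tensor \<Omega> ?A"
    unfolding symmetric_tensor_def using good
    by eventually_elim (simp add: symmetric_mat_calA)

  have spectrum: "AE x in lebesgue_on \<Omega>.
       eigenvalues (?A x) =
         {#?g x (eigval (B x) 1), ?g x (eigval (B x) 2), ?g x (eigval (B x) 3)#} \<and>
       (\<forall>i\<in>{1, 2, 3}.
          eigenspace (B x) (eigval (B x) i) \<subseteq> eigenspace (?A x) (?g x (eigval (B x) i)) \<and>
          eigenspace (?A x) (?g x (eigval (B x) i)) =
            span (\<Union>j\<in>{j \<in> {1, 2, 3}. ?g x (eigval (B x) j) = ?g x (eigval (B x) i)}.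
                    eigenspace (B x) (eigval (B x) j)))"
    using good
  proof eventually_elim
    case (elim x)
    then have sym: "symmetric_mat (B x)" and pd: "pos_def_mat (B x)" by auto
    note ev = eigenvalues_eq_eigvals[OF sym]
    have pos: "eigval (B x) i \<noteq> 0" if "i \<in> {1, 2, 3}" for i
    proof -
      have "eigval (B x) i \<in># eigenvalues (B x)" using that by (subst ev) auto
      then show ?thesis using eigenvalues_pos[OF pd] by fastforce
    qed
    have "{l \<in> set_mset (eigenvalues (B x)). ?g x l = k} =
        eigval (B x) ` {j \<in> {1, 2, 3}. ?g x (eigval (B x) j) = k}" for k
      by (subst ev) auto
    then have "eigenspace (?A x) k = span (\<Union>j\<in>{j \<in> {1, 2, 3}. ?g x (eigval (B x) j) = k}.
        eigenspace (B x) (eigval (B x) j))" for k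
      by (simp only: eigenspace_calA[where B = B and x = x, OF sym pd] image_image)
    moreover have "eigenvalues (?A x) =
        {#?g x (eigval (B x) 1), ?g x (eigval (B x) 2), ?g x (eigval (B x) 3)#}"
      by (subst eigenvalues_calA[where B = B and x = x, OF sym pd], subst ev) simp
    moreover have "eigenspace (B x) (eigval (B x) i)
        \<subseteq> eigenspace (?A x) (?g x (eigval (B x) i))" if "i \<in> {1, 2, 3}" for i
      by (rule eigenspace_subset_eigenspace_calA[where B = B and x = x,
            OF pos_def_mat_invertible[OF pd] pos[OF that]])
    ultimately show ?case by (intro conjI ballI)
  qed

  have bound_iff: "AE x in lebesgue_on \<Omega>. \<forall>c.
      (\<forall>\<xi>. c * (norm \<xi>)\<^sup>2 \<le> (?A x *v \<xi>) \<bullet> \<xi>) \<longleftrightarrow> c \<le> m x"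
    using good spectrum
  proof eventually_elim
    case (elim x)
    then have sym: "symmetric_mat (?A x)" by (simp add: symmetric_mat_calA)
    have ev: "set_mset (eigenvalues (?A x)) = (\<lambda>i. ?g x (eigval (B x) i)) ` {1, 2, 3}"
      by (subst conjunct1[OF elim(2)]) simp
    show ?case
      unfolding quadratic_form_ge_iff[OF sym] ev m_def by simp
  qed

  have \<alpha>_le: "AE x in lebesgue_on \<Omega>. \<alpha> \<le> ereal (m x)"
    unfolding \<alpha> by (rule essinf_AE_le)

  have "unif_pos_def_tensor \<Omega> ?A \<longleftrightarrow> 0 < \<alpha>"
  proof
    assume "unif_pos_def_tensor \<Omega> ?A"
    then obtain c where c: "c > 0" "AE x in lebesgue_on \<Omega>. \<forall>\<xi>. c * (norm \<xi>)\<^sup>2 \<le> (?A x *v \<xi>) \<bullet> \<xi>"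
      unfolding unif_pos_def_tensor_def by blast
    from c(2) bound_iff have "AE x in lebesgue_on \<Omega>. ereal c \<le> ereal (m x)"
      by eventually_elim simp
    then have "ereal c \<le> \<alpha>"
      unfolding \<alpha> by (rule essinf_upper)
    then show "0 < \<alpha>" using c(1) by (simp add: less_le_trans[of 0 "ereal c"])
  next
    assume "0 < \<alpha>"
    then obtain c where c: "0 < ereal c" "ereal c < \<alpha>"
      using ereal_dense2 by blast
    from \<alpha>_le bound_iff have "AE x in lebesgue_on \<Omega>. \<forall>\<xi>. c * (norm \<xi>)\<^sup>2 \<le> (?A x *v \<xi>) \<bullet> \<xi>"
    proof eventually_elim
      case (elim x)
      then have "ereal c \<le> ereal (m x)" using c(2) by (meson less_imp_le order_trans)
      with elim show ?case by simp
    qed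
    then show "unif_pos_def_tensor \<Omega> ?A"
      using c(1) unfolding unif_pos_def_tensor_def by auto
  qed
  moreover have "symmetric_tensor \<Omega> B" "pos_def_tensor \<Omega> B"
    using good by (auto simp: symmetric_tensor_def pos_def_tensor_def)
  ultimately have A_pos: "A_positive \<Omega> \<mu>1 \<mu>2 \<mu>3 B \<longleftrightarrow> 0 < \<alpha>"
    using symA by (simp add: A_positive_def)

  have "AE x in lebesgue_on \<Omega>. \<forall>\<xi>. \<alpha> * ereal ((norm \<xi>)\<^sup>2) \<le> ereal ((?A x *v \<xi>) \<bullet> \<xi>)"
    if "0 < \<alpha>"
    using \<alpha>_le bound_iff
  proof eventually_elim
    case (elim x)
    \<comment> \<open>Being positive and bounded by the real number \<open>m x\<close>, the constant is a real number.\<close>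
    with that obtain a where a: "\<alpha> = ereal a" by (cases \<alpha>) auto
    with elim show ?case by simp
  qed
  with symA spectrum A_pos show ?thesis by (intro conjI impI; (assumption | blast))
qed

end
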